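(* Assume there exists $c\in\mathcal C$ such that $e\cdot m_c<0$. Then there exists an admissible control $(Y,Z,\eta)$, with corresponding controlled process $X$, under which, $P$-a.s., $e\cdot X(t)\le0$ and $Y(t)=0$ for all $t\in[0,\infty)$.
   Context: Fluid model. Let $I,J\ge 2$, $\mathcal I=\{1,\dots,I\}$, $\mathcal J=\{I+1,\dots,I+J\}$. Let $\lambda_i,\nu_j\in(0,\infty)$, $\mu_{ij}\ge0$, $\hat\lambda_i,\hat\mu_{ij}\in\mathbb R$, $C_{U,i}\in[0,\infty)$ be constants ($i\in\mathcal I,j\in\mathcal J$; $\hat\mu_{ij}=0$ whenever $\mu_{ij}=0$), let $\mathcal E=\{(i,j):\mu_{ij}>0\}$ (activities), and let $\mathcal G$ be the graph with vertex set $\mathcal I\cup\mathcal J$ and edge set $\mathcal E$. Let $\bar\mu_{ij}=\nu_j\mu_{ij}$ and consider the linear program: minimize $\rho\in\mathbb R_+$ subject to $\sum_{j}\bar\mu_{ij}\xi_{ij}=\lambda_i$, $\sum_i\xi_{ij}\le\rho$, $\xi_{ij}\ge0$ for all $i\in\mathcal I,j\in\mathcal J$. Standing assumption (heavy traffic): it has a unique optimal solution $(\xi^*,\rho^* )$, and $\sum_i\xi^*_{ij}=1$ for all $j$ (so $\rho^*=1$). Put $\psi_{ij}^*=\xi_{ij}^*\nu_j$. An activity is basic if $\xi^*_{ij}>0$; $\mathcal E_b$ is the set of basic activities, $\mathcal E_{nb}=\mathcal E\setminus\mathcal E_b$. Standing assumption (complete resource pooling): the graph $\mathcal G_b$ with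 vertex set $\mathcal I\cup\mathcal J$ and edge set $\mathcal E_b$ is a tree. Simple cycles. $\mathcal C$ is the set of cycles that are subgraphs of $\mathcal G$ with exactly one edge being a nonbasic activity. If $c\in\mathcal C$ has nonbasic edge $(i_0,j_0)$, orient $c$ cyclically so that this edge is directed from $i_0$ to $j_0$: $i_0\to j_0\to i_1\to j_1\to\cdots\to i_k\to j_k\to i_0$. For an edge $(i,j)$ of $c$ (written $(i,j)\in c$), $s(c,i,j)=-1$ if in $c$ it is directed from $i$ to $j$, and $s(c,i,j)=1$ if directed from $j$ to $i$. Let $m_{i,c}=\sum_{j:(i,j)\in c}s(c,i,j)\mu_{ij}$ and $m_c=(m_{i,c})_{i\in\mathcal I}\in\mathbb R^I$. Here $e=(1,\dots,1)'$. The maps $G$, $H$. Let $D_G=\{(a,b)\in\mathbb R^I\times\mathbb R^J:\sum_ia_i=\sum_jb_j\}$. For $(a,b)\in D_G$ let $G(a,b)$ be the unique $\psi=(\psi_{ij})$ with $\sum_j\psi_{ij}=a_i$, $\sum_i\psi_{ij}=b_j$, and $\psi_{ij}=0$ for $(i,j)\notin\mathcal E_b$. Put $H_i(a,b)=-\sum_j\mu_{ij}G_{ij}(a,b)$, $H=(H_i)_{i\in\mathcal I}$. Diffusion model. Let $\ell=(\ell_i)$, $\ell_i=\hat\lambda_i-\sum_j\hat\mu_{ij}\psi^*_{ij}$, and $\Sigma=\mathrm{diag}(\lambda_iC_{U,i}^2+\lambda_i)$. On a complete probability space $(\Omega,\mathcal F,P)$ let $W$ be an $I$-dimensional $(\ell,\Sigma)$-Brownian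 motion (starting at $0$, with $W(1)$ having mean $\ell$ and covariance $\Sigma$), and let $(\mathcal F_t)$ be a right-continuous filtration of sub-sigma-fields of $\mathcal F$ such that $(W(t)-\ell t,\mathcal F_t:t\ge0)$ is a martingale. Let a deterministic initial condition $x\in\mathbb R^I$ be given. A triplet $(Y,Z,\eta)$, $\eta=(\eta_c)_{c\in\mathcal C}$, is an admissible control, and $X$ a corresponding controlled process, if $Y$ ($\mathbb R_+^I$-valued), $Z$ ($\mathbb R_+^J$-valued), $\eta$ ($\eta_c$ $\mathbb R_+$-valued) have cadlag sample paths, $Y$ and $Z$ are $(\mathcal F_t)$-progressively measurable, each $\eta_c$ is $(\mathcal F_t)$-adapted, and, $P$-a.s., for all $t\in[0,\infty)$: $$X(t)=x+W(t)+\int_0^tH(X(s)-Y(s),-Z(s))\,ds+\sum_{c\in\mathcal C}m_c\eta_c(t),$$ $Y_i(t)\ge0$ for $i\in\mathcal I$, $Z_j(t)\ge0$ for $j\in\mathcal J$, $\sum_{i}Y_i(t)=\sum_iX_i(t)+\sum_jZ_j(t)$, and for every $c\in\mathcal C$, $\eta_c$ is nondecreasing with $\eta_c(0)\ge0$. *)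

theory Defs
  imports "HOL-Probability.Probability" "Graph_Theory.Digraph_Component"
begin

section \<open>Fluid model\<close>

text \<open>The customer classes are the elements of a finite type \<open>'i\<close> and the server pools those of a
  finite type \<open>'j\<close>, so that the numbers of classes and pools are \<open>CARD('i)\<close> and \<open>CARD('j)\<close>.\<close>

definition lp_feasible ::
  "('i::finite \<Rightarrow> real) \<Rightarrow> ('i \<Rightarrow> 'j::finite \<Rightarrow> real) \<Rightarrow> ('i \<Rightarrow> 'j \<Rightarrow> real) \<Rightarrow> real \<Rightarrow> bool" where
  "lp_feasible lam mubar \<xi> \<rho> \<longleftrightarrow>
     \<rho> \<ge> 0 \<and>
     (\<forall>i. (\<Sum>j\<in>UNIV. mubar i j * \<xi> i j) = lam i) \<and>
     (\<forall>j. (\<Sum>i\<in>UNIV. \<xi> i j) \<le> \<rho>) \<and>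
     (\<forall>i j. \<xi> i j \<ge> 0)"

definition lp_optimal ::
  "('i::finite \<Rightarrow> real) \<Rightarrow> ('i \<Rightarrow> 'j::finite \<Rightarrow> real) \<Rightarrow> ('i \<Rightarrow> 'j \<Rightarrow> real) \<Rightarrow> real \<Rightarrow> bool" where
  "lp_optimal lam mubar \<xi> \<rho> \<longleftrightarrow>
     lp_feasible lam mubar \<xi> \<rho> \<and> (\<forall>\<xi>' \<rho>'. lp_feasible lam mubar \<xi>' \<rho>' \<longrightarrow> \<rho> \<le> \<rho>')"

definition activities :: "('i \<Rightarrow> 'j \<Rightarrow> real) \<Rightarrow> ('i \<times> 'j) set" where
  "activities \<mu> = {(i, j). \<mu> i j > 0}"

definition basic_activities ::
  "('i \<Rightarrow> 'j \<Rightarrow> real) \<Rightarrow> ('i \<Rightarrow> 'j \<Rightarrow> real) \<Rightarrow> ('i \<times> 'j) set" where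
  "basic_activities \<mu> \<xi> = {(i, j) \<in> activities \<mu>. \<xi> i j > 0}"

definition nonbasic_activities ::
  "('i \<Rightarrow> 'j \<Rightarrow> real) \<Rightarrow> ('i \<Rightarrow> 'j \<Rightarrow> real) \<Rightarrow> ('i \<times> 'j) set" where
  "nonbasic_activities \<mu> \<xi> = activities \<mu> - basic_activities \<mu> \<xi>"


section \<open>Graphs and simple cycles\<close>

text \<open>Following \<open>Graph_Theory\<close>, an undirected graph is a symmetric digraph. The vertex set is the
  disjoint union of classes and pools; every \<open>(i, j) \<in> E\<close> contributes both of its directions.\<close>

definition bip_graph :: "('i \<times> 'j) set \<Rightarrow> ('i + 'j) pair_pre_digraph" where
  "bip_graph E = \<lparr>pverts = UNIV,
     parcs = {(Inl i, Inr j) | i j. (i, j) \<in> E} \<union> {(Inr j, Inl i) | i j. (i, j) \<in> E}\<rparr>"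

text \<open>In a symmetric digraph the closed walk \<open>u, v, u\<close> counts as a \<open>cycle\<close>, hence the restriction
  on the length (and hence \<open>tree\<close> of \<open>Graph_Theory\<close> cannot be used for undirected graphs).
  The list \<open>p\<close> consists of directed arcs, so it is a cycle together with an orientation.\<close>

definition oriented_cycle :: "('i \<times> 'j) set \<Rightarrow> (('i + 'j) \<times> ('i + 'j)) list \<Rightarrow> bool" where
  "oriented_cycle E p \<longleftrightarrow> pre_digraph.cycle (with_proj (bip_graph E)) p \<and> length p \<ge> 3"

definition is_tree :: "('i \<times> 'j) set \<Rightarrow> bool" where
  "is_tree E \<longleftrightarrow>
     Digraph_Component.connected (with_proj (bip_graph E)) \<and> \<not> (\<exists>p. oriented_cycle E p)"

definition undirected_edges :: "(('i + 'j) \<times> ('i + 'j)) list \<Rightarrow> ('i \<times> 'j) set" where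
  "undirected_edges p = {(i, j). (Inl i, Inr j) \<in> set p \<or> (Inr j, Inl i) \<in> set p}"

text \<open>A cycle, as a subgraph, is identified with its set of edges.\<close>

definition simple_cycles ::
  "('i \<Rightarrow> 'j \<Rightarrow> real) \<Rightarrow> ('i \<Rightarrow> 'j \<Rightarrow> real) \<Rightarrow> ('i \<times> 'j) set set" where
  "simple_cycles \<mu> \<xi> =
     {undirected_edges p | p. oriented_cycle (activities \<mu>) p \<and>
        card (undirected_edges p \<inter> nonbasic_activities \<mu> \<xi>) = 1}"

text \<open>\<open>p\<close> runs through \<open>c\<close> in the direction in which the nonbasic edge \<open>(i0, j0)\<close> goes from
  \<open>i0\<close> to \<open>j0\<close>. Such a \<open>p\<close> is unique up to the choice of the starting point, so its set of arcs
  depends on \<open>c\<close> only.\<close>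

definition orients ::
  "('i \<Rightarrow> 'j \<Rightarrow> real) \<Rightarrow> ('i \<Rightarrow> 'j \<Rightarrow> real) \<Rightarrow> (('i + 'j) \<times> ('i + 'j)) list \<Rightarrow> ('i \<times> 'j) set \<Rightarrow> bool"
  where
  "orients \<mu> \<xi> p c \<longleftrightarrow>
     oriented_cycle (activities \<mu>) p \<and> undirected_edges p = c \<and>
     (\<exists>(i0, j0) \<in> nonbasic_activities \<mu> \<xi>. (Inl i0, Inr j0) \<in> set p)"

text \<open>Meaningful for \<open>c \<in> simple_cycles \<mu> \<xi>\<close> and \<open>(i, j) \<in> c\<close> only; then the second case says that
  the edge is directed from \<open>j\<close> to \<open>i\<close>.\<close>

definition cycle_sign ::
  "('i \<Rightarrow> 'j \<Rightarrow> real) \<Rightarrow> ('i \<Rightarrow> 'j \<Rightarrow> real) \<Rightarrow> ('i \<times> 'j) set \<Rightarrow> 'i \<Rightarrow> 'j \<Rightarrow> real" where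
  "cycle_sign \<mu> \<xi> c i j = (if \<exists>p. orients \<mu> \<xi> p c \<and> (Inl i, Inr j) \<in> set p then -1 else 1)"

definition m_vec ::
  "('i::finite \<Rightarrow> 'j::finite \<Rightarrow> real) \<Rightarrow> ('i \<Rightarrow> 'j \<Rightarrow> real) \<Rightarrow> ('i \<times> 'j) set \<Rightarrow> real ^ 'i" where
  "m_vec \<mu> \<xi> c = (\<chi> i. \<Sum>j\<in>{j. (i, j) \<in> c}. cycle_sign \<mu> \<xi> c i j * \<mu> i j)"

definition e_vec :: "real ^ 'i" where
  "e_vec = (\<chi> i. 1)"


section \<open>The maps \<open>G\<close> and \<open>H\<close>\<close>

text \<open>Only used for \<open>a\<close>, \<open>b\<close> whose components have the same total.\<close>

definition G_map ::
  "('i::finite \<Rightarrow> 'j::finite \<Rightarrow> real) \<Rightarrow> ('i \<Rightarrow> 'j \<Rightarrow> real) \<Rightarrow> real ^ 'i \<Rightarrow> real ^ 'j \<Rightarrow> 'i \<Rightarrow> 'j \<Rightarrow> real" where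
  "G_map \<mu> \<xi> a b = (THE \<psi>.
     (\<forall>i. (\<Sum>j\<in>UNIV. \<psi> i j) = a $ i) \<and>
     (\<forall>j. (\<Sum>i\<in>UNIV. \<psi> i j) = b $ j) \<and>
     (\<forall>i j. (i, j) \<notin> basic_activities \<mu> \<xi> \<longrightarrow> \<psi> i j = 0))"

definition H_map ::
  "('i::finite \<Rightarrow> 'j::finite \<Rightarrow> real) \<Rightarrow> ('i \<Rightarrow> 'j \<Rightarrow> real) \<Rightarrow> real ^ 'i \<Rightarrow> real ^ 'j \<Rightarrow> real ^ 'i" where
  "H_map \<mu> \<xi> a b = (\<chi> i. - (\<Sum>j\<in>UNIV. \<mu> i j * G_map \<mu> \<xi> a b i j))"


section \<open>Stochastic processes\<close>

text \<open>Processes are functions of a real time parameter, of which only the values at times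
  \<open>t \<ge> 0\<close> matter.\<close>

definition normal_law :: "real \<Rightarrow> real \<Rightarrow> real measure" where
  "normal_law m v =
     (if v = 0 then return borel m else density lborel (\<lambda>y. ennreal (normal_density m (sqrt v) y)))"

text \<open>Multivariate normal law (possibly degenerate): all linear functionals are normal, with the
  mean and variance determined by the mean vector and the covariance matrix.\<close>

definition mv_normal ::
  "'a measure \<Rightarrow> ('a \<Rightarrow> real ^ 'i) \<Rightarrow> real ^ 'i \<Rightarrow> real ^ 'i ^ 'i \<Rightarrow> bool" where
  "mv_normal M V m S \<longleftrightarrow>
     V \<in> borel_measurable M \<and>
     (\<forall>\<theta>. distr M borel (\<lambda>\<omega>. \<theta> \<bullet> V \<omega>) = normal_law (\<theta> \<bullet> m) (\<theta> \<bullet> (S *v \<theta>)))"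

definition brownian_motion ::
  "'a measure \<Rightarrow> real ^ 'i \<Rightarrow> real ^ 'i ^ 'i \<Rightarrow> (real \<Rightarrow> 'a \<Rightarrow> real ^ 'i) \<Rightarrow> bool" where
  "brownian_motion M drift S W \<longleftrightarrow>
     (\<forall>t\<ge>0. W t \<in> borel_measurable M) \<and>
     (AE \<omega> in M. W 0 \<omega> = 0) \<and>
     (\<forall>\<omega>\<in>space M. continuous_on {0..} (\<lambda>t. W t \<omega>)) \<and>
     (\<forall>(n::nat) \<tau>. 0 \<le> \<tau> 0 \<and> (\<forall>k<n. \<tau> k < \<tau> (Suc k)) \<longrightarrow>
        prob_space.indep_vars M (\<lambda>_. borel) (\<lambda>k \<omega>. W (\<tau> (Suc k)) \<omega> - W (\<tau> k) \<omega>) {..<n}) \<and>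
     (\<forall>s t. 0 \<le> s \<and> s < t \<longrightarrow>
        mv_normal M (\<lambda>\<omega>. W t \<omega> - W s \<omega>) ((t - s) *\<^sub>R drift) ((t - s) *\<^sub>R S))"

definition right_continuous_filtration :: "'a measure \<Rightarrow> (real \<Rightarrow> 'a measure) \<Rightarrow> bool" where
  "right_continuous_filtration M F \<longleftrightarrow>
     (\<forall>t\<ge>0. subalgebra M (F t)) \<and>
     (\<forall>s t. 0 \<le> s \<and> s \<le> t \<longrightarrow> sets (F s) \<subseteq> sets (F t)) \<and>
     (\<forall>t\<ge>0. sets (F t) = (\<Inter>s\<in>{t<..}. sets (F s)))"

definition adapted ::
  "(real \<Rightarrow> 'a measure) \<Rightarrow> (real \<Rightarrow> 'a \<Rightarrow> 'b::topological_space) \<Rightarrow> bool" where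
  "adapted F V \<longleftrightarrow> (\<forall>t\<ge>0. V t \<in> borel_measurable (F t))"

definition progressively_measurable ::
  "(real \<Rightarrow> 'a measure) \<Rightarrow> (real \<Rightarrow> 'a \<Rightarrow> 'b::topological_space) \<Rightarrow> bool" where
  "progressively_measurable F V \<longleftrightarrow>
     (\<forall>t\<ge>0. (\<lambda>(s, \<omega>). V s \<omega>) \<in> borel_measurable (restrict_space borel {0..t} \<Otimes>\<^sub>M F t))"

definition martingale ::
  "'a measure \<Rightarrow> (real \<Rightarrow> 'a measure) \<Rightarrow> (real \<Rightarrow> 'a \<Rightarrow> real ^ 'i) \<Rightarrow> bool" where
  "martingale M F V \<longleftrightarrow>
     adapted F V \<and>
     (\<forall>t\<ge>0. integrable M (V t)) \<and>
     (\<forall>s t. 0 \<le> s \<and> s \<le> t \<longrightarrow>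
        (\<forall>i. AE \<omega> in M. real_cond_exp M (F s) (\<lambda>\<omega>. V t \<omega> $ i) \<omega> = V s \<omega> $ i))"

definition cadlag :: "(real \<Rightarrow> 'b::topological_space) \<Rightarrow> bool" where
  "cadlag f \<longleftrightarrow>
     (\<forall>t\<ge>0. (f \<longlongrightarrow> f t) (at_right t)) \<and> (\<forall>t>0. \<exists>l. (f \<longlongrightarrow> l) (at_left t))"


section \<open>Diffusion model\<close>

definition drift_vec ::
  "('j::finite \<Rightarrow> real) \<Rightarrow> ('i::finite \<Rightarrow> 'j \<Rightarrow> real) \<Rightarrow> ('i \<Rightarrow> real) \<Rightarrow> ('i \<Rightarrow> 'j \<Rightarrow> real) \<Rightarrow> real ^ 'i" where
  "drift_vec \<nu> \<xi> hlam hmu = (\<chi> i. hlam i - (\<Sum>j\<in>UNIV. hmu i j * (\<xi> i j * \<nu> j)))"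

definition cov_matrix :: "('i::finite \<Rightarrow> real) \<Rightarrow> ('i \<Rightarrow> real) \<Rightarrow> real ^ 'i ^ 'i" where
  "cov_matrix lam CU = (\<chi> i k. if i = k then lam i * (CU i)\<^sup>2 + lam i else 0)"

text \<open>\<open>(Y, Z, \<eta>)\<close> is an admissible control for the initial condition \<open>x\<close>, with corresponding
  controlled process \<open>X\<close>. Integrability is stated explicitly since the integral of a
  non-integrable function is 0 by convention.\<close>

definition admissible_control ::
  "('i::finite \<Rightarrow> 'j::finite \<Rightarrow> real) \<Rightarrow> ('i \<Rightarrow> 'j \<Rightarrow> real) \<Rightarrow>
   'a measure \<Rightarrow> (real \<Rightarrow> 'a measure) \<Rightarrow> (real \<Rightarrow> 'a \<Rightarrow> real ^ 'i) \<Rightarrow> real ^ 'i \<Rightarrow>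
   (real \<Rightarrow> 'a \<Rightarrow> real ^ 'i) \<Rightarrow> (real \<Rightarrow> 'a \<Rightarrow> real ^ 'j) \<Rightarrow> (('i \<times> 'j) set \<Rightarrow> real \<Rightarrow> 'a \<Rightarrow> real) \<Rightarrow>
   (real \<Rightarrow> 'a \<Rightarrow> real ^ 'i) \<Rightarrow> bool" where
  "admissible_control \<mu> \<xi> M F W x Y Z \<eta> X \<longleftrightarrow>
     (\<forall>\<omega>\<in>space M. \<forall>t\<ge>0.
        (\<forall>i. Y t \<omega> $ i \<ge> 0) \<and> (\<forall>j. Z t \<omega> $ j \<ge> 0) \<and>
        (\<forall>c\<in>simple_cycles \<mu> \<xi>. \<eta> c t \<omega> \<ge> 0)) \<and>
     (\<forall>\<omega>\<in>space M.
        cadlag (\<lambda>t. Y t \<omega>) \<and> cadlag (\<lambda>t. Z t \<omega>) \<and>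
        (\<forall>c\<in>simple_cycles \<mu> \<xi>. cadlag (\<lambda>t. \<eta> c t \<omega>))) \<and>
     progressively_measurable F Y \<and> progressively_measurable F Z \<and>
     (\<forall>c\<in>simple_cycles \<mu> \<xi>. adapted F (\<eta> c)) \<and>
     (AE \<omega> in M.
        (\<forall>t\<ge>0.
           set_integrable lborel {0..t} (\<lambda>s. H_map \<mu> \<xi> (X s \<omega> - Y s \<omega>) (- Z s \<omega>)) \<and>
           X t \<omega> = x + W t \<omega>
             + (LINT s:{0..t}|lborel. H_map \<mu> \<xi> (X s \<omega> - Y s \<omega>) (- Z s \<omega>))
             + (\<Sum>c\<in>simple_cycles \<mu> \<xi>. \<eta> c t \<omega> *\<^sub>R m_vec \<mu> \<xi> c) \<and>
           (\<forall>i. Y t \<omega> $ i \<ge> 0) \<and>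
           (\<forall>j. Z t \<omega> $ j \<ge> 0) \<and>
           (\<Sum>i\<in>UNIV. Y t \<omega> $ i) = (\<Sum>i\<in>UNIV. X t \<omega> $ i) + (\<Sum>j\<in>UNIV. Z t \<omega> $ j)) \<and>
        (\<forall>c\<in>simple_cycles \<mu> \<xi>. mono_on {0..} (\<lambda>t. \<eta> c t \<omega>) \<and> \<eta> c 0 \<omega> \<ge> 0))"

end

theory Submission
  imports Defs
begin

text \<open>The system is controlled without any queue: \<open>Y = 0\<close>, and all the idleness is put into one
  fixed pool \<open>j0\<close>. The balance equation \<open>e \<bullet> Y = e \<bullet> X + e \<bullet> Z\<close> then forces
  \<open>Z = - (e \<bullet> X) u\<close> with \<open>u\<close> the unit vector of \<open>j0\<close>, so that the control is admissible exactly if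
  \<open>e \<bullet> X \<le> 0\<close>. This has to be achieved by a cycle \<open>c\<close> with \<open>e \<bullet> m_c < 0\<close>: increasing \<open>\<eta>_c\<close>
  pushes \<open>e \<bullet> X\<close> down.

  For this choice the drift is \<open>H (X, (e \<bullet> X) u) = L X\<close> with \<open>L\<close> linear. Linearity of \<open>G\<close>, hence of \<open>H\<close>
  and \<open>L\<close>, is where the tree of basic activities enters: flows on its edges with given row and column
  sums of equal total exist because the tree is connected (\<open>flow_exists\<close>) and are unique because it
  has no cycle (\<open>flow_unique\<close>). So \<open>X\<close> has to solve, path by path, the linear Volterra equation
  \<open>X = p + \<eta> m + \<integral> L X\<close> where \<open>p = x + W\<close> and \<open>m = m_c\<close>.

  Since \<open>\<eta>\<close> may be any nondecreasing adapted process, it can be chosen in advance, without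
  knowledge of \<open>X\<close>: put \<open>\<eta> t = C exp (a t) S t\<close> with \<open>S\<close> the running supremum of \<open>norm p\<close>. The point of the
  exponential factor is that \<open>\<integral> exp (a s) S s ds \<le> exp (a t) S t / a\<close>, because \<open>S\<close> is nondecreasing.
  Therefore the feedback term \<open>\<integral> L X\<close> is small compared with \<open>exp (a t) S t\<close> once \<open>a\<close> is large,
  and it cannot undo the push \<open>\<eta> m\<close> (\<open>exponential_push_keeps_below\<close>).

  The solution is the sum of the Picard terms of the equation, each of which is an
  adapted continuous process; so the sum \<open>X\<close> and the control are adapted, and being continuous
  they are progressively measurable.\<close>

section \<open>Cycles from branching\<close>

text \<open>Take a path of maximal length with distinct vertices. Its first vertex has a neighbour other than the
  second vertex; by maximality this neighbour already lies on the path, which closes a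
  cycle of length at least 3.\<close>

lemma min_degree_two_imp_cycle:
  fixes R :: "('v::finite \<times> 'v) set"
  assumes "sym R" and "irrefl R" and "R \<noteq> {}"
    and branch: "\<And>u v. (u, v) \<in> R \<Longrightarrow> \<exists>w. w \<noteq> v \<and> (u, w) \<in> R"
  obtains vs where "distinct vs" and "length vs \<ge> 3"
    and "successively (\<lambda>u v. (u, v) \<in> R) vs" and "(last vs, hd vs) \<in> R"
proof -
  define path where "path vs \<longleftrightarrow> distinct vs \<and> successively (\<lambda>u v. (u, v) \<in> R) vs" for vs
  obtain a b where ab: "(a, b) \<in> R"
    using \<open>R \<noteq> {}\<close> by auto
  with \<open>irrefl R\<close> have edge: "path [a, b]"
    by (auto simp: path_def irrefl_def)
  have "length vs < Suc (CARD('v))" if "path vs" for vs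
    using that distinct_card[of vs] card_mono[of UNIV "set vs"] by (auto simp: path_def)
  with edge obtain vs where vs: "path vs" and longest: "\<And>us. path us \<Longrightarrow> length us \<le> length vs"
    using ex_has_greatest_nat[of path "[a, b]" length "Suc (CARD('v))"] by blast
  from longest[OF edge] obtain v w rest where vs_eq: "vs = v # w # rest"
    by (cases vs; cases "tl vs") auto
  with vs have "(v, w) \<in> R"
    by (auto simp: path_def)
  from branch[OF this] obtain u where u: "u \<noteq> w" "(v, u) \<in> R"
    by blast
  with \<open>sym R\<close> have uv: "(u, v) \<in> R"
    by (auto dest: symD)
  have "u \<noteq> v"
    using u \<open>irrefl R\<close> by (auto simp: irrefl_def)
  have "u \<in> set vs"
  proof (rule ccontr)
    assume "u \<notin> set vs"
    with vs vs_eq uv have "path (u # vs)"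
      by (auto simp: path_def)
    from longest[OF this] show False by simp
  qed
  with u(1) \<open>u \<noteq> v\<close> vs_eq have "u \<in> set rest" by auto
  then obtain xs ys where rest: "rest = xs @ u # ys"
    by (auto dest: split_list)
  show ?thesis
  proof (rule that[of "v # w # xs @ [u]"])
    show "successively (\<lambda>u v. (u, v) \<in> R) (v # w # xs @ [u])"
    proof -
      have "vs = (v # w # xs @ [u]) @ ys"
        by (simp add: vs_eq rest)
      with vs show ?thesis
        unfolding path_def by (metis successively_append_iff)
    qed
  qed (use vs uv in \<open>auto simp: path_def vs_eq rest\<close>)
qed

text \<open>A closed walk through the vertices \<open>v # vs\<close> has the arc list \<open>zip (v # vs) (vs @ [v])\<close>. The next
  lemmas hold for an arbitrary endpoint \<open>w\<close> in place of the final \<open>v\<close> to make the induction work.\<close>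

lemma pcas_zip: "pcas v (zip (v # vs) (vs @ [w])) w"
  by (induction vs arbitrary: v) auto

lemma pawalk_verts_zip: "pawalk_verts v (zip (v # vs) (vs @ [w])) = v # vs @ [w]"
  by (induction vs arbitrary: v) auto

lemma set_zip_successively:
  "successively (\<lambda>u v. (u, v) \<in> R) (v # vs @ [w]) \<Longrightarrow> set (zip (v # vs) (vs @ [w])) \<subseteq> R"
  by (induction vs arbitrary: v) auto

lemma oriented_cycle_of_vertices:
  assumes "distinct vs" and "length vs \<ge> 3"
    and "successively (\<lambda>u v. (u, v) \<in> parcs (bip_graph E)) vs"
    and "(last vs, hd vs) \<in> parcs (bip_graph E)"
  obtains p where "oriented_cycle E p"
proof -
  obtain v vs' where vs: "vs = v # vs'"
    using assms(2) by (cases vs) auto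
  let ?p = "zip (v # vs') (vs' @ [v])"
  have "vs' \<noteq> []" using assms(2) vs by auto
  have "successively (\<lambda>u v. (u, v) \<in> parcs (bip_graph E)) (v # vs' @ [v])"
    using assms(3,4) \<open>vs' \<noteq> []\<close> unfolding vs
    by (auto simp: successively_append_iff successively_Cons)
  then have "set ?p \<subseteq> parcs (bip_graph E)"
    by (rule set_zip_successively)
  then have "pre_digraph.awalk (with_proj (bip_graph E)) v ?p v"
    unfolding pre_digraph.awalk_def cas_with_proj_eq
    using pcas_zip[of v vs' v] by (simp add: bip_graph_def del: zip_Cons_Cons)
  moreover have "distinct (tl (pre_digraph.awalk_verts (with_proj (bip_graph E)) v ?p))"
    using assms(1) vs unfolding awalk_verts_with_proj_eq pawalk_verts_zip by auto
  ultimately have "oriented_cycle E ?p"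
    unfolding oriented_cycle_def pre_digraph.cycle_def
    using assms(2) vs \<open>vs' \<noteq> []\<close> by (auto simp: zip_eq_Nil_iff)
  with that show ?thesis .
qed

text \<open>In a row or column with zero sum, one nonzero entry entails another. Hence every vertex
  on an edge of the support of \<open>\<psi>\<close> lies on two such edges, and a nonempty support
  would contain a cycle.\<close>

lemma null_flow_on_tree:
  fixes \<psi> :: "'i::finite \<Rightarrow> 'j::finite \<Rightarrow> real"
  assumes tree: "is_tree E"
    and supp: "\<And>i j. (i, j) \<notin> E \<Longrightarrow> \<psi> i j = 0"
    and rows: "\<And>i. (\<Sum>j\<in>UNIV. \<psi> i j) = 0"
    and cols: "\<And>j. (\<Sum>i\<in>UNIV. \<psi> i j) = 0"
  shows "\<psi> i j = 0"
proof (rule ccontr)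
  assume nz: "\<psi> i j \<noteq> 0"
  define S where "S = {(i, j). \<psi> i j \<noteq> 0}"
  have other: "\<exists>b. b \<noteq> a \<and> f b \<noteq> 0" if "sum f UNIV = 0" "f a \<noteq> 0"
    for f :: "'k::finite \<Rightarrow> real" and a
  proof (rule ccontr)
    assume "\<not> (\<exists>b. b \<noteq> a \<and> f b \<noteq> 0)"
    then have "sum f UNIV = f a"
      by (subst sum.remove[of _ a]) (auto intro!: sum.neutral)
    with that show False by simp
  qed
  let ?R = "parcs (bip_graph S)"
  have R: "(Inl i, Inr j) \<in> ?R \<longleftrightarrow> \<psi> i j \<noteq> 0" "(Inr j, Inl i) \<in> ?R \<longleftrightarrow> \<psi> i j \<noteq> 0" for i j
    by (auto simp: bip_graph_def S_def)
  have R_cases: "(\<exists>i j. u = Inl i \<and> v = Inr j \<and> \<psi> i j \<noteq> 0) \<or> (\<exists>i j. u = Inr j \<and> v = Inl i \<and> \<psi> i j \<noteq> 0)"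
    if "(u, v) \<in> ?R" for u v
    using that by (auto simp: bip_graph_def S_def)
  obtain vs where vs: "distinct vs" "length vs \<ge> 3"
    "successively (\<lambda>u v. (u, v) \<in> ?R) vs" "(last vs, hd vs) \<in> ?R"
  proof (rule min_degree_two_imp_cycle[of ?R])
    show "sym ?R" by (auto simp: sym_def bip_graph_def)
    show "irrefl ?R" by (auto simp: irrefl_def bip_graph_def)
    show "?R \<noteq> {}" using nz R(1) by blast
  next
    fix u v assume "(u, v) \<in> ?R"
    from R_cases[OF this] show "\<exists>w. w \<noteq> v \<and> (u, w) \<in> ?R"
    proof (elim disjE exE conjE)
      fix i j assume "u = Inl i" "v = Inr j" "\<psi> i j \<noteq> 0"
      moreover obtain j' where "j' \<noteq> j" "\<psi> i j' \<noteq> 0"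
        using other[OF rows \<open>\<psi> i j \<noteq> 0\<close>] by blast
      ultimately show ?thesis by (intro exI[of _ "Inr j'"]) (simp add: R)
    next
      fix i j assume "u = Inr j" "v = Inl i" "\<psi> i j \<noteq> 0"
      moreover obtain i' where "i' \<noteq> i" "\<psi> i' j \<noteq> 0"
        using other[of "\<lambda>i. \<psi> i j" i, OF cols \<open>\<psi> i j \<noteq> 0\<close>] by blast
      ultimately show ?thesis by (intro exI[of _ "Inl i'"]) (simp add: R)
    qed
  qed
  have sub: "?R \<subseteq> parcs (bip_graph E)"
    using supp by (auto simp: bip_graph_def S_def)
  have "successively (\<lambda>u v. (u, v) \<in> parcs (bip_graph E)) vs"
    by (rule successively_mono[OF vs(3)]) (use sub in auto)
  from oriented_cycle_of_vertices[OF vs(1,2) this] sub vs(4) tree show False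
    unfolding is_tree_def by blast
qed

section \<open>Flows on the tree of basic activities\<close>

text \<open>The defining property of \<open>G (a, b)\<close>, for an arbitrary set \<open>E\<close> of edges.\<close>

definition flow :: "('i \<times> 'j) set \<Rightarrow> real ^ 'i \<Rightarrow> real ^ 'j \<Rightarrow> ('i::finite \<Rightarrow> 'j::finite \<Rightarrow> real) \<Rightarrow> bool" where
  "flow E a b \<psi> \<longleftrightarrow>
     (\<forall>i. (\<Sum>j\<in>UNIV. \<psi> i j) = a $ i) \<and>
     (\<forall>j. (\<Sum>i\<in>UNIV. \<psi> i j) = b $ j) \<and>
     (\<forall>i j. (i, j) \<notin> E \<longrightarrow> \<psi> i j = 0)"

lemma flow_add: "flow E a b \<psi> \<Longrightarrow> flow E a' b' \<psi>' \<Longrightarrow> flow E (a + a') (b + b') (\<lambda>i j. \<psi> i j + \<psi>' i j)"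
  by (simp add: flow_def sum.distrib)

lemma flow_diff: "flow E a b \<psi> \<Longrightarrow> flow E a' b' \<psi>' \<Longrightarrow> flow E (a - a') (b - b') (\<lambda>i j. \<psi> i j - \<psi>' i j)"
  by (simp add: flow_def sum_subtractf)

lemma flow_scale: "flow E a b \<psi> \<Longrightarrow> flow E (r *\<^sub>R a) (r *\<^sub>R b) (\<lambda>i j. r * \<psi> i j)"
  by (simp add: flow_def flip: sum_distrib_left)

lemma flow_zero: "flow E 0 0 (\<lambda>i j. 0)"
  by (simp add: flow_def)

lemma flow_sum:
  assumes "finite A" and "\<And>k. k \<in> A \<Longrightarrow> \<exists>\<psi>. flow E (a k) (b k) \<psi>"
  shows "\<exists>\<psi>. flow E (\<Sum>k\<in>A. a k) (\<Sum>k\<in>A. b k) \<psi>"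
  using assms
proof (induction A rule: finite_induct)
  case empty
  show ?case using flow_zero[of E] by auto
next
  case (insert k A)
  then obtain \<psi> \<psi>' where "flow E (a k) (b k) \<psi>" "flow E (\<Sum>k\<in>A. a k) (\<Sum>k\<in>A. b k) \<psi>'"
    by blast
  from flow_add[OF this] insert show ?case by auto
qed

lemma flow_edge:
  assumes "(i, j) \<in> E"
  shows "flow E (axis i 1) (axis j 1) (\<lambda>i' j'. if i' = i \<and> j' = j then 1 else 0)"
  unfolding flow_def
proof (intro conjI allI impI)
  show "(\<Sum>j'\<in>UNIV. if i' = i \<and> j' = j then 1 else 0) = axis i 1 $ i'" for i'
    by (cases "i' = i") (simp_all add: axis_def)
  show "(\<Sum>i'\<in>UNIV. if i' = i \<and> j' = j then 1 else 0) = axis j 1 $ j'" for j'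
    by (cases "j' = j") (simp_all add: axis_def)
qed (use assms in auto)

text \<open>The sign makes the two sides of the bipartite graph symmetric: the unit flow along an edge \<open>(i, j)\<close> has
  row and column sums \<open>potential (Inl i) - potential (Inr j)\<close>. So if unit flows are added with alternating
  signs along a walk, then their row and column sums telescope.\<close>

fun potential :: "'i::finite + 'j::finite \<Rightarrow> (real ^ 'i) \<times> (real ^ 'j)" where
  "potential (Inl i) = (axis i 1, 0)"
| "potential (Inr j) = (0, - axis j 1)"

lemma flow_between_vertices:
  fixes E :: "('i::finite \<times> 'j::finite) set"
  assumes "is_tree E"
  shows "\<exists>\<psi>. flow E (fst (potential u - potential v)) (snd (potential u - potential v)) \<psi>"
proof -
  let ?G = "mk_symmetric (with_proj (bip_graph E))"
  have arcs: "arcs_ends (with_proj ?G) = parcs (bip_graph E)"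
    by (auto simp: arcs_ends_def arc_to_ends_def mk_symmetric_def bip_graph_def)
  have verts: "verts (with_proj ?G) = UNIV"
    by (simp add: mk_symmetric_def bip_graph_def)
  have "u \<rightarrow>\<^sup>*\<^bsub>?G\<^esub> v"
    using assms verts
    unfolding is_tree_def Digraph_Component.connected_def strongly_connected_def by blast
  then have "(u, v) \<in> rtrancl_on UNIV (parcs (bip_graph E))"
    unfolding reachable_def arcs verts .
  then show ?thesis
  proof (induction rule: rtrancl_on_induct)
    case base
    show ?case using flow_zero[of E] by auto
  next
    case (step v w)
    have "\<exists>\<psi>. flow E (fst (potential v - potential w)) (snd (potential v - potential w)) \<psi>"
    proof -
      from step(2) consider i j where "v = Inl i" "w = Inr j" "(i, j) \<in> E"
        | i j where "v = Inr j" "w = Inl i" "(i, j) \<in> E"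
        by (auto simp: bip_graph_def)
      then show ?thesis
      proof cases
        case 1
        then show ?thesis using flow_edge[of i j E] by (intro exI) simp
      next
        case 2
        then show ?thesis using flow_scale[OF flow_edge[of i j E], of "-1"] by (intro exI) simp
      qed
    qed
    with step(5) obtain \<psi> \<psi>'
      where "flow E (fst (potential u - potential v)) (snd (potential u - potential v)) \<psi>"
        "flow E (fst (potential v - potential w)) (snd (potential v - potential w)) \<psi>'"
      by blast
    from flow_add[OF this] show ?case by auto
  qed
qed

text \<open>The pair \<open>(a, b)\<close> is a combination of the potentials of the vertices, with coefficients of total
  zero by the balance condition. So it is also a combination of potential
  differences to a fixed vertex \<open>r\<close>, each of which is carried by a flow.\<close>

lemma flow_exists:
  fixes E :: "('i::finite \<times> 'j::finite) set"
  assumes "is_tree E" and bal: "(\<Sum>i\<in>UNIV. a $ i) = (\<Sum>j\<in>UNIV. b $ j)"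
  shows "\<exists>\<psi>. flow E a b \<psi>"
proof -
  define c :: "'i + 'j \<Rightarrow> real" where "c v = (case v of Inl i \<Rightarrow> a $ i | Inr j \<Rightarrow> - b $ j)" for v
  have sum_sum: "(\<Sum>v\<in>UNIV. f v) = (\<Sum>i\<in>UNIV. f (Inl i)) + (\<Sum>j\<in>UNIV. f (Inr j))"
    for f :: "'i + 'j \<Rightarrow> 'c::ab_group_add"
    by (simp add: sum.Plus flip: UNIV_Plus_UNIV)
  have c0: "(\<Sum>v\<in>UNIV. c v) = 0"
    by (simp add: sum_sum c_def bal sum_negf)
  fix r :: "'i + 'j"
  have "(\<Sum>v\<in>UNIV. c v *\<^sub>R potential v) = (a, b)"
  proof -
    have "(\<Sum>i\<in>UNIV. a $ i *\<^sub>R (axis i 1 :: real ^ 'i)) = a" "(\<Sum>j\<in>UNIV. b $ j *\<^sub>R (axis j 1 :: real ^ 'j)) = b"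
      using basis_expansion[of a] basis_expansion[of b] by (simp_all add: scalar_mult_eq_scaleR)
    then show ?thesis
      by (intro prod_eqI) (simp_all add: sum_sum c_def fst_sum snd_sum)
  qed
  then have *: "(\<Sum>v\<in>UNIV. c v *\<^sub>R (potential v - potential r)) = (a, b)"
    by (simp add: scaleR_diff_right sum_subtractf c0 flip: scaleR_sum_left)
  have "\<exists>\<psi>. flow E (\<Sum>v\<in>UNIV. fst (c v *\<^sub>R (potential v - potential r)))
      (\<Sum>v\<in>UNIV. snd (c v *\<^sub>R (potential v - potential r))) \<psi>"
  proof (rule flow_sum)
    fix v
    obtain \<psi> where "flow E (fst (potential v - potential r)) (snd (potential v - potential r)) \<psi>"
      using flow_between_vertices[OF \<open>is_tree E\<close>] by blast
    from flow_scale[OF this, of "c v"]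
    show "\<exists>\<psi>. flow E (fst (c v *\<^sub>R (potential v - potential r)))
        (snd (c v *\<^sub>R (potential v - potential r))) \<psi>"
      by auto
  qed simp
  then show ?thesis
    unfolding fst_sum[symmetric] snd_sum[symmetric] * by simp
qed

lemma flow_unique:
  assumes "is_tree E" and "flow E a b \<psi>" and "flow E a b \<psi>'"
  shows "\<psi> = \<psi>'"
proof (intro ext)
  fix i j
  have "flow E 0 0 (\<lambda>i j. \<psi> i j - \<psi>' i j)"
    using flow_diff[OF assms(2,3)] by simp
  then have "\<psi> i j - \<psi>' i j = 0"
    using null_flow_on_tree[OF assms(1), of "\<lambda>i j. \<psi> i j - \<psi>' i j" i j]
    by (simp add: flow_def)
  then show "\<psi> i j = \<psi>' i j" by simp
qed

lemma G_map_eqI: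
  assumes "is_tree (basic_activities \<mu> \<xi>)" and "flow (basic_activities \<mu> \<xi>) a b \<psi>"
  shows "G_map \<mu> \<xi> a b = \<psi>"
  unfolding G_map_def flow_def[symmetric]
  using assms by (intro the_equality) (auto intro: flow_unique)

text \<open>By uniqueness, \<open>G\<close> of a linear combination is the linear combination of the flows.\<close>

lemma linear_H_map:
  fixes B :: "real ^ 'i \<Rightarrow> real ^ 'j"
  assumes tree: "is_tree (basic_activities (\<mu> :: 'i::finite \<Rightarrow> 'j::finite \<Rightarrow> real) \<xi>)"
    and "linear B" and bal: "\<And>a. (\<Sum>i\<in>UNIV. a $ i) = (\<Sum>j\<in>UNIV. B a $ j)"
  shows "linear (\<lambda>a. H_map \<mu> \<xi> a (B a))"
proof -
  interpret B: linear B by fact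
  let ?G = "\<lambda>a. G_map \<mu> \<xi> a (B a)"
  have G: "flow (basic_activities \<mu> \<xi>) a (B a) (?G a)" for a
    using flow_exists[OF tree bal[of a]] G_map_eqI[OF tree] by metis
  have "?G (a + a') = (\<lambda>i j. ?G a i j + ?G a' i j)" for a a'
    using flow_add[OF G[of a] G[of a']] by (intro G_map_eqI[OF tree]) (simp add: B.add)
  moreover have "?G (r *\<^sub>R a) = (\<lambda>i j. r * ?G a i j)" for r a
    using flow_scale[OF G[of a], of r] by (intro G_map_eqI[OF tree]) (simp add: B.scaleR)
  ultimately show ?thesis
    by (intro linearI)
      (simp_all add: H_map_def vec_eq_iff algebra_simps sum.distrib sum_distrib_left)
qed

lemma continuous_on_halflineI:
  fixes f :: "real \<Rightarrow> 'b::topological_space"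
  assumes "\<And>T. 0 \<le> T \<Longrightarrow> continuous_on {0..T} f"
  shows "continuous_on {0..} f"
  unfolding continuous_on_eq_continuous_within
proof
  fix t :: real assume "t \<in> {0..}"
  then have "continuous (at t within {0..t + 1}) f"
    using assms[of "t + 1"] by (simp add: continuous_on_eq_continuous_within)
  moreover have "at t within {0..} = at t within {0..t + 1}"
    by (rule at_within_nhd[of t "{t - 1<..<t + 1}"]) auto
  ultimately show "continuous (at t within {0..}) f"
    by simp
qed

lemma continuous_on_integral_halfline:
  fixes f :: "real \<Rightarrow> 'b::banach"
  assumes "continuous_on {0..} f"
  shows "continuous_on {0..} (\<lambda>t. integral {0..t} f)"
  by (intro continuous_on_halflineI indefinite_integral_continuous_1
      integrable_continuous_interval continuous_on_subset[OF assms]) auto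

section \<open>Linear Volterra equations\<close>

text \<open>The increments of the Picard iteration for \<open>X t = g t + \<integral> L (X s) ds\<close>. The solution is kept as an
  explicit series because that is what later shows its adaptedness.\<close>

primrec volterra_term :: "('b \<Rightarrow> 'b) \<Rightarrow> (real \<Rightarrow> 'b) \<Rightarrow> nat \<Rightarrow> real \<Rightarrow> 'b::euclidean_space" where
  "volterra_term L g 0 = g"
| "volterra_term L g (Suc n) = (\<lambda>t. integral {0..t} (\<lambda>s. L (volterra_term L g n s)))"

definition volterra_solution :: "('b \<Rightarrow> 'b) \<Rightarrow> (real \<Rightarrow> 'b) \<Rightarrow> real \<Rightarrow> 'b::euclidean_space" where
  "volterra_solution L g t = (\<Sum>n. volterra_term L g n t)"

lemma continuous_volterra_term:
  assumes "bounded_linear L" and "continuous_on {0..} g"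
  shows "continuous_on {0..} (volterra_term L g n)"
proof (induction n)
  case (Suc n)
  then show ?case
    by (auto intro!: continuous_on_integral_halfline bounded_linear.continuous_on[OF assms(1)])
qed (simp add: assms(2))

text \<open>Growth is measured against the weight \<open>exp (a t) * S t\<close>. For \<open>S\<close> nondecreasing, applying
  \<open>\<integral> L\<close> multiplies such a bound by at most \<open>K / a\<close>, which makes the Picard
  series geometric as soon as \<open>a\<close> exceeds the bound \<open>K\<close> of \<open>L\<close>.\<close>

locale linear_volterra =
  fixes L :: "'b::euclidean_space \<Rightarrow> 'b" and g :: "real \<Rightarrow> 'b" and K a :: real and S :: "real \<Rightarrow> real"
  assumes L: "bounded_linear L" and L_bound: "norm (L v) \<le> K * norm v"
    and K_nonneg: "0 \<le> K" and K_less: "K < a"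
    and g_cont: "continuous_on {0..} g"
    and g_bound: "0 \<le> t \<Longrightarrow> norm (g t) \<le> exp (a * t) * S t"
    and S_mono: "mono_on {0..} S"
begin

abbreviation "q \<equiv> K / a"

lemma q: "0 \<le> q" "q < 1"
  using K_nonneg K_less by auto

lemma S_nonneg: "0 \<le> t \<Longrightarrow> 0 \<le> S t"
  using order_trans[OF norm_ge_zero g_bound[of t]] by (simp add: zero_le_mult_iff)

text \<open>In the induction step \<open>S s\<close> is replaced by \<open>S t\<close> under the integral,
  and \<open>exp (a s)\<close> integrates to at most \<open>exp (a t) / a\<close>.\<close>

lemma term_bound: "0 \<le> t \<Longrightarrow> norm (volterra_term L g n t) \<le> q ^ n * (exp (a * t) * S t)"
proof (induction n arbitrary: t)
  case 0
  then show ?case using g_bound by simp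
next
  case (Suc n)
  let ?C = "K * q ^ n * S t"
  have "a > 0" using K_nonneg K_less by simp
  have C: "0 \<le> ?C" using q K_nonneg S_nonneg Suc.prems by simp
  have int: "((\<lambda>s. ?C * exp (a * s)) has_integral (?C * (exp (a * t) / a) - ?C * (exp (a * 0) / a))) {0..t}"
    using Suc.prems \<open>a > 0\<close>
    by (intro fundamental_theorem_of_calculus)
      (auto intro!: derivative_eq_intros simp flip: has_real_derivative_iff_has_vector_derivative)
  have "norm (integral {0..t} (\<lambda>s. L (volterra_term L g n s))) \<le> integral {0..t} (\<lambda>s. ?C * exp (a * s))"
  proof (rule integral_norm_bound_integral)
    have "continuous_on {0..t} (volterra_term L g n)"
      by (rule continuous_on_subset[OF continuous_volterra_term[OF L g_cont]]) auto
    then show "(\<lambda>s. L (volterra_term L g n s)) integrable_on {0..t}"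
      by (intro integrable_continuous_interval bounded_linear.continuous_on[OF L])
    show "(\<lambda>s. ?C * exp (a * s)) integrable_on {0..t}"
      using int by blast
  next
    fix s assume s: "s \<in> {0..t}"
    have "norm (L (volterra_term L g n s)) \<le> K * norm (volterra_term L g n s)"
      by (rule L_bound)
    also have "\<dots> \<le> K * (q ^ n * (exp (a * s) * S s))"
      using s Suc.IH[of s] K_nonneg by (intro mult_left_mono) auto
    also have "\<dots> \<le> K * (q ^ n * (exp (a * s) * S t))"
      using s q K_nonneg mono_onD[OF S_mono, of s t] by (intro mult_left_mono) auto
    finally show "norm (L (volterra_term L g n s)) \<le> ?C * exp (a * s)"
      by (simp add: mult_ac)
  qed
  also have "\<dots> = ?C * (exp (a * t) / a) - ?C * (exp (a * 0) / a)"
    using int by (rule integral_unique)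
  also have "\<dots> \<le> ?C * (exp (a * t) / a)"
    using C \<open>a > 0\<close> by simp
  finally show ?case
    by (simp add: mult_ac)
qed

lemma partial_sums_uniform_limit:
  assumes "0 \<le> T"
  shows "uniform_limit {0..T} (\<lambda>n t. \<Sum>k<n. volterra_term L g k t) (volterra_solution L g) sequentially"
  unfolding volterra_solution_def
proof (rule Weierstrass_m_test)
  fix n t assume t: "t \<in> {0..T}"
  have "0 < a" using K_nonneg K_less by simp
  have "exp (a * t) * S t \<le> exp (a * T) * S T"
    using t \<open>0 < a\<close> S_nonneg[of t] mono_onD[OF S_mono, of t T] by (intro mult_mono) auto
  with term_bound[of t n] t q show "norm (volterra_term L g n t) \<le> q ^ n * (exp (a * T) * S T)"
    by (meson atLeastAtMost_iff mult_left_mono order_trans zero_le_power)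
next
  show "summable (\<lambda>n. q ^ n * (exp (a * T) * S T))"
    using q by (intro summable_mult2 summable_geometric) auto
qed

lemma continuous_solution: "continuous_on {0..} (volterra_solution L g)"
proof (rule continuous_on_halflineI)
  fix T :: real assume "0 \<le> T"
  have "continuous_on {0..T} (\<lambda>t. \<Sum>k<n. volterra_term L g k t)" for n
    by (intro continuous_on_sum continuous_on_subset[OF continuous_volterra_term[OF L g_cont]]) auto
  then show "continuous_on {0..T} (volterra_solution L g)"
    by (intro uniform_limit_theorem[OF _ partial_sums_uniform_limit[OF \<open>0 \<le> T\<close>]] always_eventually) auto
qed

lemma solution_equation:
  assumes "0 \<le> t"
  shows "volterra_solution L g t = g t + integral {0..t} (\<lambda>s. L (volterra_solution L g s))"
proof -
  let ?U = "\<lambda>n s. \<Sum>k<n. volterra_term L g k s"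
  have cont: "continuous_on {0..t} (volterra_term L g n)" for n
    by (intro continuous_on_subset[OF continuous_volterra_term[OF L g_cont]]) auto
  have unif: "uniform_limit {0..t} (\<lambda>n s. L (?U n s)) (\<lambda>s. L (volterra_solution L g s)) sequentially"
    by (rule bounded_linear.uniform_limit[OF L partial_sums_uniform_limit[OF assms]])
  obtain I J where I: "\<And>n. ((\<lambda>s. L (?U n s)) has_integral I n) {0..t}"
    and J: "((\<lambda>s. L (volterra_solution L g s)) has_integral J) {0..t}" and lim: "I \<longlonglongrightarrow> J"
    by (rule uniform_limit_integral[OF unif])
      (auto intro!: bounded_linear.continuous_on[OF L] continuous_on_sum cont)
  have "I n = (\<Sum>k<n. volterra_term L g (Suc k) t)" for n
  proof -
    have "I n = integral {0..t} (\<lambda>s. \<Sum>k<n. L (volterra_term L g k s))"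
      using integral_unique[OF I[of n]]
      by (simp add: linear_sum[OF bounded_linear.linear[OF L]])
    also have "\<dots> = (\<Sum>k<n. integral {0..t} (\<lambda>s. L (volterra_term L g k s)))"
      by (intro integral_sum) (auto intro!: integrable_continuous_interval bounded_linear.continuous_on[OF L] cont)
    finally show ?thesis by simp
  qed
  then have "?U (Suc n) t = g t + I n" for n
    by (simp add: sum.lessThan_Suc_shift del: sum.lessThan_Suc)
  with lim have "(\<lambda>n. ?U (Suc n) t) \<longlonglongrightarrow> g t + J"
    by (auto intro!: tendsto_intros)
  moreover have "(\<lambda>n. ?U n t) \<longlonglongrightarrow> volterra_solution L g t"
    using tendsto_uniform_limitI[OF partial_sums_uniform_limit[OF assms]] assms by auto
  ultimately have "volterra_solution L g t = g t + J"
    using LIMSEQ_unique LIMSEQ_Suc by blast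
  with integral_unique[OF J] show ?thesis by simp
qed

text \<open>The difference is the Picard series without its first term, bounded by a geometric series.\<close>

lemma solution_deviation:
  assumes "0 \<le> t"
  shows "norm (volterra_solution L g t - g t) \<le> q / (1 - q) * (exp (a * t) * S t)"
proof -
  let ?w = "exp (a * t) * S t"
  have sm: "summable (\<lambda>n. q ^ n * (q * ?w))"
    using q by (intro summable_mult2 summable_geometric) auto
  have bound: "norm (volterra_term L g (Suc n) t) \<le> q ^ n * (q * ?w)" for n
    using term_bound[OF assms, of "Suc n"] by (simp only: power_Suc mult_ac)
  have "summable (\<lambda>n. volterra_term L g (Suc n) t)"
    by (rule summable_comparison_test'[OF sm bound])
  then have "summable (\<lambda>n. volterra_term L g n t)"
    by (rule summable_Suc_iff[THEN iffD1])
  from suminf_split_head[OF this]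
  have "volterra_solution L g t - g t = (\<Sum>n. volterra_term L g (Suc n) t)"
    by (simp add: volterra_solution_def)
  also have "norm \<dots> \<le> (\<Sum>n. q ^ n * (q * ?w))"
    by (rule norm_suminf_le[OF bound sm])
  also have "\<dots> = (\<Sum>n. q ^ n) * (q * ?w)"
    using q by (intro suminf_mult2[symmetric] summable_geometric) auto
  also have "\<dots> = q / (1 - q) * ?w"
    using q by (subst suminf_geometric) auto
  finally show ?thesis .
qed

end

section \<open>The running supremum\<close>

definition running_sup :: "(real \<Rightarrow> real) \<Rightarrow> real \<Rightarrow> real" where
  "running_sup f t = (SUP s\<in>{0..t}. f s)"

context
  fixes f :: "real \<Rightarrow> real"
  assumes f: "continuous_on {0..} f"
begin

lemma bdd_above_path: "bdd_above (f ` {0..t})"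
  by (intro bounded_imp_bdd_above compact_imp_bounded compact_continuous_image
      continuous_on_subset[OF f]) auto

lemma le_running_sup: "0 \<le> s \<Longrightarrow> s \<le> t \<Longrightarrow> f s \<le> running_sup f t"
  unfolding running_sup_def by (intro cSUP_upper bdd_above_path) auto

lemma running_sup_le: "0 \<le> t \<Longrightarrow> (\<And>s. 0 \<le> s \<Longrightarrow> s \<le> t \<Longrightarrow> f s \<le> C) \<Longrightarrow> running_sup f t \<le> C"
  unfolding running_sup_def by (intro cSUP_least) auto

lemma mono_running_sup: "mono_on {0..} (running_sup f)"
  by (intro mono_onI running_sup_le) (auto intro: le_running_sup)

lemma continuous_running_sup: "continuous_on {0..} (running_sup f)"
proof (rule continuous_on_halflineI)
  fix T :: real assume "0 \<le> T"
  have "uniformly_continuous_on {0..T} f"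
    by (intro compact_uniformly_continuous continuous_on_subset[OF f]) auto
  then have "uniformly_continuous_on {0..T} (running_sup f)"
    unfolding uniformly_continuous_on_def
  proof (intro allI impI)
    fix e :: real
    assume unif: "\<forall>e>0. \<exists>d>0. \<forall>x\<in>{0..T}. \<forall>x'\<in>{0..T}. dist x' x < d \<longrightarrow> dist (f x') (f x) < e" and "0 < e"
    then obtain d where "d > 0" and d: "\<And>x x'. \<lbrakk>x \<in> {0..T}; x' \<in> {0..T}; dist x' x < d\<rbrakk> \<Longrightarrow> dist (f x') (f x) < e / 2"
      by (meson half_gt_zero)
    have *: "dist (running_sup f t) (running_sup f s) < e"
      if "0 \<le> s" "s \<le> t" "t \<le> T" "t - s < d" for s t
    proof -
      have "running_sup f t \<le> running_sup f s + e / 2"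
      proof (rule running_sup_le)
        fix u assume u: "0 \<le> u" "u \<le> t"
        show "f u \<le> running_sup f s + e / 2"
        proof (cases "u \<le> s")
          case True
          with u \<open>0 < e\<close> le_running_sup[of u s] show ?thesis by simp
        next
          case False
          then have "dist (f u) (f s) < e / 2"
            using that u by (intro d) (auto simp: dist_real_def)
          then have "f u \<le> f s + e / 2"
            unfolding dist_real_def by linarith
          with le_running_sup[of s s] that show ?thesis by simp
        qed
      qed (use that in simp)
      moreover have "running_sup f s \<le> running_sup f t"
        using that by (intro mono_onD[OF mono_running_sup]) auto
      ultimately show ?thesis using \<open>0 < e\<close> by (simp add: dist_real_def)
    qed
    have "dist (running_sup f x') (running_sup f x) < e"
      if "x \<in> {0..T}" "x' \<in> {0..T}" "dist x' x < d" for x x'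
      using that *[of x x'] *[of x' x]
      by (cases "x \<le> x'") (auto simp: dist_real_def)
    then show "\<exists>d>0. \<forall>x\<in>{0..T}. \<forall>x'\<in>{0..T}. dist x' x < d \<longrightarrow> dist (running_sup f x') (running_sup f x) < e"
      using \<open>d > 0\<close> by blast
  qed
  then show "continuous_on {0..T} (running_sup f)"
    by (rule uniformly_continuous_imp_continuous)
qed

text \<open>The parametrisation by rational fractions of \<open>t\<close> expresses the running supremum at time \<open>t\<close> by
  countably many values of the path up to time \<open>t\<close>, which gives its measurability.\<close>

lemma running_sup_rational:
  assumes "0 \<le> t"
  shows "running_sup f t = (SUP r\<in>{0<..<1} \<inter> \<rat>. f (r * t))"
    and "bdd_above ((\<lambda>r. f (r * t)) ` ({0<..<1} \<inter> \<rat>))"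
proof -
  let ?Q = "{0<..<1::real} \<inter> \<rat>"
  have cl: "closure ?Q = {0..1}"
    using closure_open_Int_superset[of "{0<..<1::real}" \<rat>] by (simp add: Rats_closure_real)
  then have ne: "?Q \<noteq> {}" by (metis atLeastatMost_empty_iff2 closure_eq_empty zero_le_one)
  have in_interval: "0 \<le> r * t" "r * t \<le> t" if "r \<in> {0..1}" for r
    using that assms mult_left_le_one_le[of t r] by auto
  show bdd: "bdd_above ((\<lambda>r. f (r * t)) ` ?Q)"
    using in_interval by (intro bdd_aboveI2[of _ _ "running_sup f t"] le_running_sup) auto
  show "running_sup f t = (SUP r\<in>?Q. f (r * t))"
  proof (rule antisym)
    show "(SUP r\<in>?Q. f (r * t)) \<le> running_sup f t"
      using in_interval ne by (intro cSUP_least le_running_sup) auto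
    show "running_sup f t \<le> (SUP r\<in>?Q. f (r * t))"
    proof (rule running_sup_le[OF assms])
      fix s assume s: "0 \<le> s" "s \<le> t"
      then have "s / t \<in> closure ?Q"
        unfolding cl by (auto simp: divide_le_eq_1)
      moreover have "continuous_on (closure ?Q) (\<lambda>r. f (r * t))"
        unfolding cl using in_interval
        by (intro continuous_on_compose2[OF f]) (auto intro!: continuous_intros)
      ultimately have "f (s / t * t) \<le> (SUP r\<in>?Q. f (r * t))"
        using continuous_le_on_closure[of ?Q "\<lambda>r. f (r * t)" "s / t" "SUP r\<in>?Q. f (r * t)"]
          cSUP_upper[OF _ bdd] by simp
      then show "f s \<le> (SUP r\<in>?Q. f (r * t))"
        using s by (cases "t = 0") auto
    qed
  qed
qed

end

section \<open>Adapted processes with continuous paths\<close>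

lemma adapted_later:
  assumes "right_continuous_filtration M F" and "adapted F V" and "0 \<le> s" "s \<le> t"
  shows "V s \<in> borel_measurable (F t)"
proof -
  have "subalgebra M (F s)" "subalgebra M (F t)" "sets (F s) \<subseteq> sets (F t)"
    using assms(1,3,4) order_trans[OF assms(3,4)]
    unfolding right_continuous_filtration_def by blast+
  then have "subalgebra (F t) (F s)"
    by (simp add: subalgebra_def)
  moreover have "V s \<in> borel_measurable (F s)"
    using assms by (simp add: adapted_def)
  ultimately show ?thesis
    by (rule measurable_from_subalg)
qed

lemma space_filtration: "right_continuous_filtration M F \<Longrightarrow> 0 \<le> t \<Longrightarrow> space (F t) = space M"
  unfolding right_continuous_filtration_def subalgebra_def by blast

text \<open>Rounding the time down to a multiple of \<open>1 / (n + 1)\<close> gives processes that are jointly measurable, since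
  only countably many times occur, and that converge to \<open>V\<close> by continuity. Rounding
  down, not up, keeps the times at or before \<open>t\<close>, so only \<open>F t\<close> is involved.\<close>

lemma adapted_continuous_imp_progressively_measurable:
  fixes V :: "real \<Rightarrow> 'a \<Rightarrow> 'b::metric_space"
  assumes F: "right_continuous_filtration M F" and V: "adapted F V"
    and cont: "\<And>\<omega>. \<omega> \<in> space M \<Longrightarrow> continuous_on {0..} (\<lambda>t. V t \<omega>)"
  shows "progressively_measurable F V"
  unfolding progressively_measurable_def
proof (intro allI impI)
  fix t :: real assume t: "0 \<le> t"
  let ?N = "restrict_space borel {0..t} \<Otimes>\<^sub>M F t"
  \<comment> \<open>For times \<open>s\<close> up to \<open>t\<close> the minimum has no effect; it makes every value of \<open>u n\<close> a time
    at which \<open>V\<close> is measurable with respect to \<open>F t\<close>.\<close>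
  define u where "u n s = min t (real (nat \<lfloor>real (Suc n) * s\<rfloor>) / real (Suc n))" for n and s :: real
  have "(\<lambda>z. V (u n (fst z)) (snd z)) \<in> borel_measurable ?N" for n
  proof -
    have "(\<lambda>s::real. nat \<lfloor>real (Suc n) * s\<rfloor>) \<in> borel \<rightarrow>\<^sub>M count_space UNIV"
      by measurable
    then have "(\<lambda>z. nat \<lfloor>real (Suc n) * fst z\<rfloor>) \<in> ?N \<rightarrow>\<^sub>M count_space UNIV"
      by (intro measurable_compose[OF measurable_fst] measurable_restrict_space1)
    moreover have "(\<lambda>z. V (min t (real k / real (Suc n))) (snd z)) \<in> borel_measurable ?N" for k
      using t by (intro measurable_compose[OF measurable_snd] adapted_later[OF F V]) auto
    ultimately show ?thesis
      unfolding u_def by (rule measurable_compose_countable[rotated])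
  qed
  then have "(\<lambda>z. V (fst z) (snd z)) \<in> borel_measurable ?N"
  proof (rule borel_measurable_LIMSEQ_metric[where f = "\<lambda>n z. V (u n (fst z)) (snd z)"])
    fix z assume "z \<in> space ?N"
    then have "fst z \<in> {0..t}" and "snd z \<in> space (F t)"
      by (simp_all add: space_pair_measure space_restrict_space mem_Times_iff)
    then have s: "0 \<le> fst z" "fst z \<le> t" and \<omega>: "snd z \<in> space M"
      unfolding space_filtration[OF F t] by simp_all
    have lower: "fst z - 1 / real (Suc n) \<le> u n (fst z)" and upper: "u n (fst z) \<le> fst z" for n
    proof -
      let ?k = "real (nat \<lfloor>real (Suc n) * fst z\<rfloor>)"
      have "0 \<le> real (Suc n) * fst z"
        using s by simp
      then have "real (Suc n) * fst z - 1 \<le> ?k" "?k \<le> real (Suc n) * fst z"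
        by linarith (rule of_nat_floor, fact)
      moreover have "w - 1 / N \<le> k / N" "k / N \<le> w"
        if "0 < N" "N * w - 1 \<le> k" "k \<le> N * w" for N w k :: real
        using that by (simp_all add: pos_le_divide_eq pos_divide_le_eq left_diff_distrib right_diff_distrib mult.commute)
      ultimately have "fst z - 1 / real (Suc n) \<le> ?k / real (Suc n)" "?k / real (Suc n) \<le> fst z"
        by (meson of_nat_0_less_iff zero_less_Suc)+
      then show "fst z - 1 / real (Suc n) \<le> u n (fst z)" "u n (fst z) \<le> fst z"
        using s by (auto simp: u_def min_def intro: order_trans[of _ "fst z"])
    qed
    have "(\<lambda>n. u n (fst z)) \<longlonglongrightarrow> fst z"
    proof (rule tendsto_sandwich)
      show "(\<lambda>n. fst z - 1 / real (Suc n)) \<longlonglongrightarrow> fst z"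
        using tendsto_diff[OF tendsto_const[of "fst z"] LIMSEQ_inverse_real_of_nat]
        by (simp add: inverse_eq_divide)
    qed (use lower upper in auto)
    then show "(\<lambda>n. V (u n (fst z)) (snd z)) \<longlonglongrightarrow> V (fst z) (snd z)"
      using s t by (intro continuous_on_tendsto_compose[OF cont[OF \<omega>]]) (auto simp: u_def)
  qed
  then show "(\<lambda>(s, \<omega>). V s \<omega>) \<in> borel_measurable ?N"
    by (simp add: case_prod_beta')
qed

text \<open>Progressive measurability provides the joint measurability on \<open>{0..t}\<close> that Fubini's theorem asks for.\<close>

lemma adapted_integral:
  fixes V :: "real \<Rightarrow> 'a \<Rightarrow> 'b::euclidean_space"
  assumes F: "right_continuous_filtration M F" and V: "adapted F V"
    and cont: "\<And>\<omega>. \<omega> \<in> space M \<Longrightarrow> continuous_on {0..} (\<lambda>t. V t \<omega>)"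
  shows "adapted F (\<lambda>t \<omega>. integral {0..t} (\<lambda>s. V s \<omega>))"
  unfolding adapted_def
proof (intro allI impI)
  fix t :: real assume t: "0 \<le> t"
  let ?I = "restrict_space lborel {0..t}"
  interpret sigma_finite_measure ?I
    by (rule sigma_finite_measure_restrict_space) (auto simp: sigma_finite_lborel)
  have "(\<lambda>(s, \<omega>). V s \<omega>) \<in> borel_measurable (restrict_space borel {0..t} \<Otimes>\<^sub>M F t)"
    using adapted_continuous_imp_progressively_measurable[OF F V cont] t
    by (simp add: progressively_measurable_def)
  also have "borel_measurable (restrict_space borel {0..t} \<Otimes>\<^sub>M F t) = borel_measurable (?I \<Otimes>\<^sub>M F t)"
    by (intro measurable_cong_sets sets_pair_measure_cong sets_restrict_space_cong) auto
  finally have "(\<lambda>(\<omega>, s). V s \<omega>) \<in> borel_measurable (F t \<Otimes>\<^sub>M ?I)"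
    by (rule measurable_pair_swap[where f = "\<lambda>(s, \<omega>). V s \<omega>", simplified])
  then have meas: "(\<lambda>\<omega>. \<integral>s. V s \<omega> \<partial>?I) \<in> borel_measurable (F t)"
    by (rule borel_measurable_lebesgue_integral)
  have eq: "(\<integral>s. V s \<omega> \<partial>?I) = integral {0..t} (\<lambda>s. V s \<omega>)" if "\<omega> \<in> space (F t)" for \<omega>
  proof -
    have "continuous_on {0..t} (\<lambda>s. V s \<omega>)"
      using that space_filtration[OF F t] by (intro continuous_on_subset[OF cont]) auto
    from set_borel_integral_eq_integral(2)[OF borel_integrable_atLeastAtMost'[OF this]]
    show ?thesis
      by (simp add: integral_restrict_space set_lebesgue_integral_def)
  qed
  from meas show "(\<lambda>\<omega>. integral {0..t} (\<lambda>s. V s \<omega>)) \<in> borel_measurable (F t)"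
    by (rule measurable_cong[THEN iffD1, rotated]) (rule eq)
qed

lemma adapted_running_sup:
  assumes F: "right_continuous_filtration M F" and V: "adapted F V"
    and cont: "\<And>\<omega>. \<omega> \<in> space M \<Longrightarrow> continuous_on {0..} (\<lambda>t. V t \<omega>)"
  shows "adapted F (\<lambda>t \<omega>. running_sup (\<lambda>s. V s \<omega>) t)"
  unfolding adapted_def
proof (intro allI impI)
  fix t :: real assume t: "0 \<le> t"
  let ?Q = "{0<..<1::real} \<inter> \<rat>"
  have meas: "(\<lambda>\<omega>. SUP r\<in>?Q. V (r * t) \<omega>) \<in> borel_measurable (F t)"
  proof (rule borel_measurable_cSUP)
    show "countable ?Q"
      using countable_rat by (rule countable_subset[rotated]) auto
    show "V (r * t) \<in> borel_measurable (F t)" if "r \<in> ?Q" for r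
      using that t by (intro adapted_later[OF F V]) (auto simp: mult_left_le_one_le)
    show "bdd_above ((\<lambda>r. V (r * t) \<omega>) ` ?Q)" if "\<omega> \<in> space (F t)" for \<omega>
      using that running_sup_rational(2)[OF cont t] space_filtration[OF F t] by auto
  qed
  have eq: "(SUP r\<in>?Q. V (r * t) \<omega>) = running_sup (\<lambda>s. V s \<omega>) t" if "\<omega> \<in> space (F t)" for \<omega>
    using that running_sup_rational(1)[OF cont t] space_filtration[OF F t] by auto
  from meas show "(\<lambda>\<omega>. running_sup (\<lambda>s. V s \<omega>) t) \<in> borel_measurable (F t)"
    by (rule measurable_cong[THEN iffD1, rotated]) (rule eq)
qed

lemma adapted_volterra_solution:
  fixes V :: "real \<Rightarrow> 'a \<Rightarrow> 'b::euclidean_space"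
  assumes F: "right_continuous_filtration M F" and L: "bounded_linear L" and V: "adapted F V"
    and cont: "\<And>\<omega>. \<omega> \<in> space M \<Longrightarrow> continuous_on {0..} (\<lambda>t. V t \<omega>)"
  shows "adapted F (\<lambda>t \<omega>. volterra_solution L (\<lambda>s. V s \<omega>) t)"
proof -
  have [measurable]: "L \<in> borel_measurable borel"
    by (intro borel_measurable_continuous_onI linear_continuous_on L)
  have "adapted F (\<lambda>t \<omega>. volterra_term L (\<lambda>s. V s \<omega>) n t)" for n
  proof (induction n)
    case 0
    show ?case using V by simp
  next
    case (Suc n)
    then have "adapted F (\<lambda>t \<omega>. L (volterra_term L (\<lambda>s. V s \<omega>) n t))"
      unfolding adapted_def by (auto intro: measurable_compose)
    then show ?case
      unfolding volterra_term.simps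
      by (rule adapted_integral[OF F])
        (intro bounded_linear.continuous_on[OF L] continuous_volterra_term[OF L] cont)
  qed
  then show ?thesis
    unfolding adapted_def volterra_solution_def by (auto intro!: borel_measurable_suminf)
qed

section \<open>Keeping the solution in a half-space\<close>

text \<open>Every continuous \<open>g\<close> is bounded by a weight of the required form, with \<open>S\<close> the running supremum of
  \<open>norm g\<close>. Hence the Picard series solves the equation for every continuous \<open>g\<close>.\<close>

lemma linear_volterra_of_continuous:
  fixes g :: "real \<Rightarrow> 'b::euclidean_space"
  assumes L: "bounded_linear L" and g: "continuous_on {0..} g"
  obtains K a S where "linear_volterra L g K a S"
proof -
  interpret L: bounded_linear L by fact
  obtain K where K: "0 < K" "\<And>v. norm (L v) \<le> norm v * K"
    using L.pos_bounded by blast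
  have cont: "continuous_on {0..} (\<lambda>s. norm (g s))"
    by (intro continuous_on_norm g)
  have "linear_volterra L g K (K + 1) (running_sup (\<lambda>s. norm (g s)))"
  proof
    fix t :: real assume t: "0 \<le> t"
    have "norm (g t) \<le> running_sup (\<lambda>s. norm (g s)) t"
      using t by (intro le_running_sup[OF cont]) auto
    also have "\<dots> \<le> exp ((K + 1) * t) * running_sup (\<lambda>s. norm (g s)) t"
      using t K(1) order_trans[OF norm_ge_zero calculation]
      by (intro mult_right_le_one_le[THEN order_trans] mult_le_cancel_right1[THEN iffD2]) auto
    finally show "norm (g t) \<le> exp ((K + 1) * t) * running_sup (\<lambda>s. norm (g s)) t" .
  qed (use K L g mono_running_sup[OF cont] in \<open>auto simp: mult.commute\<close>)
  with that show ?thesis .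
qed

text \<open>The choice of \<open>\<eta>\<close>, as a function of the path \<open>p\<close> that has to be compensated.\<close>

definition push :: "real \<Rightarrow> real \<Rightarrow> (real \<Rightarrow> 'b::real_normed_vector) \<Rightarrow> real \<Rightarrow> real" where
  "push C a p t = C * (exp (a * t) * running_sup (\<lambda>s. norm (p s)) t)"

lemma norm_le_running_sup:
  assumes "continuous_on {0..} p" and "0 \<le> t"
  shows "norm (p t) \<le> running_sup (\<lambda>s. norm (p s)) t"
  using assms by (intro le_running_sup continuous_on_norm) auto

lemma running_sup_norm_nonneg:
  assumes "continuous_on {0..} p" and "0 \<le> t"
  shows "0 \<le> running_sup (\<lambda>s. norm (p s)) t"
  using norm_le_running_sup[OF assms] norm_ge_zero order_trans by blast

lemma continuous_push: "continuous_on {0..} p \<Longrightarrow> continuous_on {0..} (push C a p)"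
  unfolding push_def
  by (intro continuous_intros continuous_running_sup continuous_on_norm)

lemma push_nonneg: "continuous_on {0..} p \<Longrightarrow> 0 \<le> C \<Longrightarrow> 0 \<le> t \<Longrightarrow> 0 \<le> push C a p t"
  by (simp add: push_def running_sup_norm_nonneg)

lemma mono_push:
  assumes "continuous_on {0..} p" and "0 \<le> C" and "0 \<le> a"
  shows "mono_on {0..} (push C a p)"
proof (rule mono_onI)
  fix s t :: real assume "s \<in> {0..}" "t \<in> {0..}" "s \<le> t"
  then show "push C a p s \<le> push C a p t"
    unfolding push_def using assms
    by (intro mult_left_mono mult_mono mono_onD[OF mono_running_sup])
      (auto intro: running_sup_norm_nonneg continuous_on_norm mult_left_mono)
qed

text \<open>Write \<open>w = exp (a t) S t\<close>, where \<open>S\<close> is the running supremum of \<open>norm p\<close>. The path \<open>p\<close> contributes at most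
  \<open>norm e * w\<close> to the inner product and the push contributes \<open>C (e \<bullet> m) w = - 2 norm e * w\<close>. By
  \<open>solution_deviation\<close> the integral term contributes at most
  \<open>norm e * w\<close>, and the total is at most 0.\<close>

lemma exponential_push_keeps_below:
  fixes L :: "'b::euclidean_space \<Rightarrow> 'b" and e m :: 'b
  assumes L: "bounded_linear L" and neg: "e \<bullet> m < 0"
  obtains C a where "0 \<le> C" and "0 \<le> a"
    and "\<And>p t. continuous_on {0..} p \<Longrightarrow> 0 \<le> t \<Longrightarrow>
      e \<bullet> volterra_solution L (\<lambda>s. p s + push C a p s *\<^sub>R m) t \<le> 0"
proof -
  interpret L: bounded_linear L by fact
  obtain K where K: "0 < K" "\<And>v. norm (L v) \<le> norm v * K"
    using L.pos_bounded by blast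
  \<comment> \<open>\<open>C\<close> makes the push twice as strong as the path. Then \<open>1 + r\<close> bounds the size of \<open>p + \<eta> m\<close>
    relative to the weight, and \<open>a\<close> is chosen such that the sum \<open>q / (1 - q)\<close> of the
    geometric series, for \<open>q = K / a\<close>, equals \<open>1 / (1 + r)\<close>.\<close>
  define C where "C = 2 * norm e / - (e \<bullet> m)"
  define r where "r = C * norm m"
  define a where "a = K * (2 + r)"
  have C: "0 \<le> C" "C * (e \<bullet> m) = - 2 * norm e"
    using neg by (auto simp: C_def field_simps)
  have r: "0 \<le> r" using C by (simp add: r_def)
  have a: "K < a" "0 \<le> a"
    using K(1) r by (auto simp: a_def algebra_simps intro: add_pos_nonneg)
  have below: "e \<bullet> volterra_solution L (\<lambda>s. p s + push C a p s *\<^sub>R m) t \<le> 0"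
    if p: "continuous_on {0..} p" and t: "0 \<le> t" for p t
  proof -
    define S where "S = running_sup (\<lambda>s. norm (p s))"
    let ?g = "\<lambda>s. p s + push C a p s *\<^sub>R m"
    have S: "norm (p t) \<le> exp (a * t) * S t" if "0 \<le> t" for t
    proof -
      have "norm (p t) \<le> S t"
        unfolding S_def using p that by (rule norm_le_running_sup)
      also have "\<dots> \<le> exp (a * t) * S t"
        using that a running_sup_norm_nonneg[OF p that] by (simp add: S_def mult_le_cancel_right1)
      finally show ?thesis .
    qed
    interpret linear_volterra L ?g K a "\<lambda>t. (1 + r) * S t"
    proof
      have S_mono: "mono_on {0..} S"
        unfolding S_def by (intro mono_running_sup continuous_on_norm p)
      show "mono_on {0..} (\<lambda>t. (1 + r) * S t)"
      proof (rule mono_onI)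
        fix u v :: real assume "u \<in> {0..}" "v \<in> {0..}" "u \<le> v"
        then show "(1 + r) * S u \<le> (1 + r) * S v"
          using mono_onD[OF S_mono] r by (intro mult_left_mono) auto
      qed
    next
      fix t :: real assume t: "0 \<le> t"
      have "norm (?g t) \<le> norm (p t) + push C a p t * norm m"
        using norm_triangle_ineq[of "p t" "push C a p t *\<^sub>R m"] push_nonneg[OF p C(1) t] by simp
      also have "\<dots> \<le> exp (a * t) * S t + r * (exp (a * t) * S t)"
        using S[OF t] by (simp add: push_def S_def r_def mult_ac)
      finally show "norm (?g t) \<le> exp (a * t) * ((1 + r) * S t)"
        by (simp add: algebra_simps)
    qed (use K a L p in \<open>auto simp: mult.commute intro!: continuous_intros continuous_push\<close>)
    have "q = 1 / (2 + r)"
      using K(1) by (simp add: a_def)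
    moreover have "1 - 1 / (2 + r) = (1 + r) / (2 + r)"
      using r by (simp add: field_simps)
    ultimately have gain: "q / (1 - q) * (1 + r) = 1"
      using r by simp
    have "q / (1 - q) * (exp (a * t) * ((1 + r) * S t)) = q / (1 - q) * (1 + r) * (exp (a * t) * S t)"
      by (simp only: mult_ac)
    also have "\<dots> = exp (a * t) * S t"
      unfolding gain by simp
    finally have "q / (1 - q) * (exp (a * t) * ((1 + r) * S t)) = exp (a * t) * S t" .
    with solution_deviation[OF t] have dev: "norm (volterra_solution L ?g t - ?g t) \<le> exp (a * t) * S t"
      by (simp only:)
    have "e \<bullet> volterra_solution L ?g t
        = e \<bullet> (volterra_solution L ?g t - ?g t) + e \<bullet> p t + C * (e \<bullet> m) * (exp (a * t) * S t)"
      by (simp add: inner_diff_right inner_add_right push_def S_def mult_ac)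
    also have "\<dots> \<le> norm e * (exp (a * t) * S t) + norm e * (exp (a * t) * S t)
        + C * (e \<bullet> m) * (exp (a * t) * S t)"
      using dev S[OF t]
      by (intro add_mono order_refl order_trans[OF norm_cauchy_schwarz] mult_left_mono) auto
    also have "\<dots> = 0"
      by (simp add: C)
    finally show ?thesis .
  qed
  from C(1) a(2) below show ?thesis by (rule that)
qed

section \<open>The control\<close>

lemma adapted_push:
  fixes V :: "real \<Rightarrow> 'a \<Rightarrow> 'b::euclidean_space"
  assumes F: "right_continuous_filtration M F" and V: "adapted F V"
    and cont: "\<And>\<omega>. \<omega> \<in> space M \<Longrightarrow> continuous_on {0..} (\<lambda>t. V t \<omega>)"
  shows "adapted F (\<lambda>t \<omega>. push C a (\<lambda>s. V s \<omega>) t)"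
proof -
  have "adapted F (\<lambda>t \<omega>. norm (V t \<omega>))"
    using V by (auto simp: adapted_def)
  then have "adapted F (\<lambda>t \<omega>. running_sup (\<lambda>s. norm (V s \<omega>)) t)"
    by (rule adapted_running_sup[OF F]) (intro continuous_on_norm cont)
  then show ?thesis
    unfolding adapted_def push_def by (auto intro!: borel_measurable_times)
qed

lemma continuous_imp_cadlag:
  fixes f :: "real \<Rightarrow> 'b::topological_space"
  assumes f: "continuous_on {0..} f"
  shows "cadlag f"
  unfolding cadlag_def
proof (intro conjI allI impI)
  fix t :: real assume "0 \<le> t"
  with f have "(f \<longlongrightarrow> f t) (at t within {0..})"
    by (simp add: continuous_on_def)
  then show "(f \<longlongrightarrow> f t) (at_right t)"
    by (rule tendsto_within_subset) (use \<open>0 \<le> t\<close> in auto)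
next
  fix t :: real assume "0 < t"
  then have "isCont f t"
    by (intro continuous_on_interior[OF f]) (simp add: interior_Ici[of "-1"])
  then have "(f \<longlongrightarrow> f t) (at_left t)"
    unfolding isCont_def by (rule tendsto_within_subset) auto
  then show "\<exists>l. (f \<longlongrightarrow> l) (at_left t)" ..
qed

theorem theorem2p2:
  fixes lam hlam CU :: "'i::finite \<Rightarrow> real"
    and \<nu> :: "'j::finite \<Rightarrow> real"
    and \<mu> hmu \<xi> :: "'i \<Rightarrow> 'j \<Rightarrow> real"
    and \<rho> :: real
    and M :: "'a measure"
    and F :: "real \<Rightarrow> 'a measure"
    and W :: "real \<Rightarrow> 'a \<Rightarrow> real ^ 'i"
    and x :: "real ^ 'i"
  assumes "CARD('i) \<ge> 2" and "CARD('j) \<ge> 2"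
    and "\<And>i. lam i > 0" and "\<And>j. \<nu> j > 0" and "\<And>i j. \<mu> i j \<ge> 0"
    and "\<And>i. CU i \<ge> 0" and "\<And>i j. \<mu> i j = 0 \<Longrightarrow> hmu i j = 0"
    and heavy_traffic:
      "lp_optimal lam (\<lambda>i j. \<nu> j * \<mu> i j) \<xi> \<rho>"
      "\<And>\<xi>' \<rho>'. lp_optimal lam (\<lambda>i j. \<nu> j * \<mu> i j) \<xi>' \<rho>' \<Longrightarrow> \<xi>' = \<xi> \<and> \<rho>' = \<rho>"
      "\<And>j. (\<Sum>i\<in>UNIV. \<xi> i j) = 1"
    and resource_pooling: "is_tree (basic_activities \<mu> \<xi>)"
    and "prob_space M" and "complete_measure M"
    and "brownian_motion M (drift_vec \<nu> \<xi> hlam hmu) (cov_matrix lam CU) W"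
    and "right_continuous_filtration M F"
    and "martingale M F (\<lambda>t \<omega>. W t \<omega> - t *\<^sub>R drift_vec \<nu> \<xi> hlam hmu)"
    and "\<exists>c\<in>simple_cycles \<mu> \<xi>. e_vec \<bullet> m_vec \<mu> \<xi> c < 0"
  shows "\<exists>Y Z \<eta> X. admissible_control \<mu> \<xi> M F W x Y Z \<eta> X \<and>
           (AE \<omega> in M. \<forall>t\<ge>0. e_vec \<bullet> X t \<omega> \<le> 0 \<and> Y t \<omega> = 0)"
proof -
  note F = \<open>right_continuous_filtration M F\<close>
  obtain c where c: "c \<in> simple_cycles \<mu> \<xi>" and neg: "e_vec \<bullet> m_vec \<mu> \<xi> c < 0"
    using assms by blast
  have total: "e_vec \<bullet> a = (\<Sum>i\<in>UNIV. a $ i)" for a :: "real ^ 'i"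
    by (simp add: e_vec_def inner_vec_def)
  fix j0 :: 'j
  \<comment> \<open>\<open>- B (X t)\<close> will be the idleness process: all of it is in the pool \<open>j0\<close>.\<close>
  define B :: "real ^ 'i \<Rightarrow> real ^ 'j" where "B a = (e_vec \<bullet> a) *\<^sub>R axis j0 1" for a
  define L where "L a = H_map \<mu> \<xi> a (B a)" for a
  have B_lin: "bounded_linear B"
    unfolding B_def by (intro bounded_linear_scaleR_const bounded_linear_inner_right)
  have B_total: "(\<Sum>j\<in>UNIV. B a $ j) = e_vec \<bullet> a" for a
    by (simp add: B_def axis_def if_distrib cong: if_cong)
  have L: "bounded_linear L"
    unfolding L_def linear_conv_bounded_linear[symmetric]
    using B_lin B_total total
    by (intro linear_H_map[OF resource_pooling]) (auto intro: bounded_linear.linear)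
  obtain C a where C: "0 \<le> C" and a: "0 \<le> a"
    and below: "\<And>p t. continuous_on {0..} p \<Longrightarrow> 0 \<le> t \<Longrightarrow>
      e_vec \<bullet> volterra_solution L (\<lambda>s. p s + push C a p s *\<^sub>R m_vec \<mu> \<xi> c) t \<le> 0"
    using exponential_push_keeps_below[OF L neg] by blast

  define V where "V t \<omega> = x + W t \<omega>" for t \<omega>
  define h where "h t \<omega> = push C a (\<lambda>s. V s \<omega>) t" for t \<omega>
  define g where "g t \<omega> = V t \<omega> + h t \<omega> *\<^sub>R m_vec \<mu> \<xi> c" for t \<omega>
  define X where "X t \<omega> = volterra_solution L (\<lambda>s. g s \<omega>) t" for t \<omega>
  have V_cont: "continuous_on {0..} (\<lambda>t. V t \<omega>)" if "\<omega> \<in> space M" for \<omega>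
    using that \<open>brownian_motion M _ _ W\<close>
    by (auto simp: V_def brownian_motion_def intro!: continuous_intros)
  have h_cont: "continuous_on {0..} (\<lambda>t. h t \<omega>)" if "\<omega> \<in> space M" for \<omega>
    unfolding h_def by (rule continuous_push[OF V_cont[OF that]])
  have g_cont: "continuous_on {0..} (\<lambda>t. g t \<omega>)" if "\<omega> \<in> space M" for \<omega>
    unfolding g_def by (intro continuous_intros V_cont h_cont that)
  have X_cont: "continuous_on {0..} (\<lambda>t. X t \<omega>)"
    and X_eq: "0 \<le> t \<Longrightarrow> X t \<omega> = g t \<omega> + integral {0..t} (\<lambda>s. L (X s \<omega>))"
    if "\<omega> \<in> space M" for t \<omega>
  proof -
    from linear_volterra_of_continuous[OF L g_cont[OF that]]
    obtain K b S where "linear_volterra L (\<lambda>s. g s \<omega>) K b S" .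
    then interpret linear_volterra L "\<lambda>s. g s \<omega>" K b S .
    show "continuous_on {0..} (\<lambda>t. X t \<omega>)"
      unfolding X_def by (rule continuous_solution)
    show "0 \<le> t \<Longrightarrow> X t \<omega> = g t \<omega> + integral {0..t} (\<lambda>s. L (X s \<omega>))"
      unfolding X_def by (rule solution_equation)
  qed
  have X_below: "e_vec \<bullet> X t \<omega> \<le> 0" if "\<omega> \<in> space M" "0 \<le> t" for t \<omega>
    unfolding X_def g_def h_def by (rule below[OF V_cont[OF that(1)] that(2)])

  have V_adapted: "adapted F V"
    unfolding adapted_def
  proof (intro allI impI)
    fix t :: real assume "0 \<le> t"
    then have "(\<lambda>\<omega>. W t \<omega> - t *\<^sub>R drift_vec \<nu> \<xi> hlam hmu) \<in> borel_measurable (F t)"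
      using \<open>martingale M F _\<close> by (simp add: martingale_def adapted_def)
    then have "(\<lambda>\<omega>. (x + t *\<^sub>R drift_vec \<nu> \<xi> hlam hmu) + (W t \<omega> - t *\<^sub>R drift_vec \<nu> \<xi> hlam hmu))
        \<in> borel_measurable (F t)"
      by (intro borel_measurable_add borel_measurable_const)
    then show "V t \<in> borel_measurable (F t)"
      by (simp add: V_def[abs_def] algebra_simps)
  qed
  have h_adapted: "adapted F h"
    using adapted_push[OF F V_adapted V_cont] by (simp add: h_def[abs_def])
  have "adapted F g"
    using V_adapted h_adapted unfolding adapted_def g_def
    by (auto intro!: borel_measurable_add borel_measurable_scaleR)
  from adapted_volterra_solution[OF F L this g_cont]
  have X_adapted: "adapted F X"
    by (simp add: X_def[abs_def])

  define Y :: "real \<Rightarrow> 'a \<Rightarrow> real ^ 'i" where "Y = (\<lambda>t \<omega>. 0)"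
  define Z :: "real \<Rightarrow> 'a \<Rightarrow> real ^ 'j" where "Z = (\<lambda>t \<omega>. - B (X t \<omega>))"
  define \<eta> where "\<eta> = (\<lambda>c' t \<omega>. if c' = c then h t \<omega> else 0)"
  have Z_cont: "continuous_on {0..} (\<lambda>t. Z t \<omega>)" if "\<omega> \<in> space M" for \<omega>
    unfolding Z_def by (intro continuous_intros bounded_linear.continuous_on[OF B_lin] X_cont that)
  have "adapted F Z"
  proof -
    have "B \<in> borel_measurable borel"
      by (intro borel_measurable_continuous_onI linear_continuous_on B_lin)
    then show ?thesis
      using X_adapted unfolding adapted_def Z_def by (auto intro: measurable_compose)
  qed
  have Z_nonneg: "0 \<le> Z t \<omega> $ j" if "\<omega> \<in> space M" "0 \<le> t" for t \<omega> j
    using X_below[OF that] by (auto simp: Z_def B_def axis_def)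
  have h_nonneg: "0 \<le> h t \<omega>" if "\<omega> \<in> space M" "0 \<le> t" for t \<omega>
    unfolding h_def using V_cont[OF that(1)] C that(2) by (rule push_nonneg)
  have h_mono: "mono_on {0..} (\<lambda>t. h t \<omega>)" if "\<omega> \<in> space M" for \<omega>
    unfolding h_def using mono_push[OF V_cont[OF that] C a] .
  have drift: "H_map \<mu> \<xi> (X s \<omega> - Y s \<omega>) (- Z s \<omega>) = L (X s \<omega>)" for s \<omega>
    by (simp add: L_def Y_def Z_def)
  have drift_integral: "set_integrable lborel {0..t} (\<lambda>s. L (X s \<omega>))"
      "(LINT s:{0..t}|lborel. L (X s \<omega>)) = integral {0..t} (\<lambda>s. L (X s \<omega>))"
    if "\<omega> \<in> space M" for t \<omega>
  proof -
    have "continuous_on {0..t} (\<lambda>s. L (X s \<omega>))"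
      by (intro bounded_linear.continuous_on[OF L] continuous_on_subset[OF X_cont[OF that]]) auto
    then show int: "set_integrable lborel {0..t} (\<lambda>s. L (X s \<omega>))"
      by (rule borel_integrable_atLeastAtMost')
    from set_borel_integral_eq_integral(2)[OF int]
    show "(LINT s:{0..t}|lborel. L (X s \<omega>)) = integral {0..t} (\<lambda>s. L (X s \<omega>))" .
  qed
  have cycles: "(\<Sum>c'\<in>simple_cycles \<mu> \<xi>. \<eta> c' t \<omega> *\<^sub>R m_vec \<mu> \<xi> c') = h t \<omega> *\<^sub>R m_vec \<mu> \<xi> c" for t \<omega>
  proof -
    have "(\<Sum>c'\<in>simple_cycles \<mu> \<xi>. \<eta> c' t \<omega> *\<^sub>R m_vec \<mu> \<xi> c')
        = (\<Sum>c'\<in>{c}. \<eta> c' t \<omega> *\<^sub>R m_vec \<mu> \<xi> c')"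
      using c by (intro sum.mono_neutral_right) (auto simp: \<eta>_def)
    then show ?thesis by (simp add: \<eta>_def)
  qed
  have "admissible_control \<mu> \<xi> M F W x Y Z \<eta> X"
    unfolding admissible_control_def drift cycles
  proof (intro conjI AE_I2 ballI allI impI)
    show "progressively_measurable F Y"
      by (rule adapted_continuous_imp_progressively_measurable[OF F]) (auto simp: Y_def adapted_def)
    show "progressively_measurable F Z"
      by (rule adapted_continuous_imp_progressively_measurable[OF F \<open>adapted F Z\<close> Z_cont])
    show "adapted F (\<eta> c')" for c'
      using h_adapted by (auto simp: \<eta>_def adapted_def)
  next
    fix \<omega> assume \<omega>: "\<omega> \<in> space M"
    show "cadlag (\<lambda>t. Y t \<omega>)" "cadlag (\<lambda>t. Z t \<omega>)"
      using Z_cont[OF \<omega>] by (auto intro!: continuous_imp_cadlag simp: Y_def)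
    show "cadlag (\<lambda>t. \<eta> c' t \<omega>)" for c'
      using h_cont[OF \<omega>] by (cases "c' = c") (auto intro!: continuous_imp_cadlag simp: \<eta>_def)
    show "mono_on {0..} (\<lambda>t. \<eta> c' t \<omega>)" "0 \<le> \<eta> c' 0 \<omega>" for c'
      using h_mono[OF \<omega>] h_nonneg[OF \<omega>] by (cases "c' = c"; auto simp: \<eta>_def intro: mono_onI)+
    fix t :: real assume t: "0 \<le> t"
    show "0 \<le> \<eta> c' t \<omega>" for c'
      using h_nonneg[OF \<omega> t] by (simp add: \<eta>_def)
    show "0 \<le> Y t \<omega> $ i" "0 \<le> Y t \<omega> $ i" for i
      by (simp_all add: Y_def)
    show "0 \<le> Z t \<omega> $ j" "0 \<le> Z t \<omega> $ j" for j
      using Z_nonneg[OF \<omega> t] by simp_all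
    show "set_integrable lborel {0..t} (\<lambda>s. L (X s \<omega>))"
      by (rule drift_integral(1)[OF \<omega>])
    show "X t \<omega> = x + W t \<omega> + (LINT s:{0..t}|lborel. L (X s \<omega>)) + h t \<omega> *\<^sub>R m_vec \<mu> \<xi> c"
      using X_eq[OF \<omega> t] drift_integral(2)[OF \<omega>, of t] by (simp add: g_def V_def)
    show "(\<Sum>i\<in>UNIV. Y t \<omega> $ i) = (\<Sum>i\<in>UNIV. X t \<omega> $ i) + (\<Sum>j\<in>UNIV. Z t \<omega> $ j)"
      by (simp add: Y_def Z_def sum_negf B_total total)
  qed
  moreover have "AE \<omega> in M. \<forall>t\<ge>0. e_vec \<bullet> X t \<omega> \<le> 0 \<and> Y t \<omega> = 0"
    using X_below by (auto simp: Y_def)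
  ultimately show ?thesis by blast
qed

end
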